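(* Let $q>2$ be fixed, let $\overline{\bm Q}_{ij}^n\in\mathcal G$, and let the limiting values in cell $I_{ij}$ be modified by the positivity-preserving (PP) limiter with parameter $q$ described in the context. Then the conservative states $\widetilde{\bm Q}^{n,+}_{i-\frac12,j},\ \widetilde{\bm Q}^{n,-}_{i+\frac12,j},\ \widetilde{\bm Q}^{n,+}_{i,j-\frac12},\ \widetilde{\bm Q}^{n,-}_{i,j+\frac12}$ corresponding to the modified primitive limiting values satisfy the following two properties: (1) $\widetilde{\bm Q}^{n,+}_{i-\frac12,j},\ \widetilde{\bm Q}^{n,-}_{i+\frac12,j},\ \widetilde{\bm Q}^{n,+}_{i,j-\frac12},\ \widetilde{\bm Q}^{n,-}_{i,j+\frac12}\in\mathcal G$; (2) for all $\bm v_*\in\mathbb R^3$, with $\bm n_*=\left(\frac{|\bm v_*|^2}{2},-\bm v_*,1\right)^\top$, $$q\,\overline{\bm Q}_{ij}^{n}\cdot\bm n_*\ \ge\ C_x\left(\widetilde{\bm Q}^{n,-}_{i+\frac12,j}+\widetilde{\bm Q}^{n,+}_{i-\frac12,j}\right)\cdot\bm n_*+C_y\left(\widetilde{\bm Q}^{n,+}_{i,j-\frac12}+\widetilde{\bm Q}^{n,-}_{i,j+\frac12}\right)\cdot\bm n_* .$$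
   Context: Constants: $\gamma>1$ (ratio of specific heats), mesh sizes $\Delta x,\Delta y>0$, numerical viscosity parameters $\alpha_1,\alpha_2>0$, a small $\epsilon>0$ (e.g. $10^{-14}$). $I_{ij}$ is the cell with center $(x_i,y_j)$ of a uniform rectangular mesh; $|\cdot|$ is the Euclidean norm. States and admissible set: $\bm Q=(\rho,\bm m,E)^\top$ with $\rho,E\in\mathbb R$, $\bm m\in\mathbb R^3$, and $\mathcal G=\{\bm Q:\rho>0,\ E-\frac{|\bm m|^2}{2\rho}>0\}$. Primitive variables $\bm W=(\rho,\bm v,p)^\top$ with $\bm v=\bm m/\rho\in\mathbb R^3$, $p=(\gamma-1)\left(E-\frac{|\bm m|^2}{2\rho}\right)$; conversely $\bm m=\rho\bm v$, $E=\frac{p}{\gamma-1}+\frac12\rho|\bm v|^2$. Reconstruction: $\overline{\bm W}_{ij}^n=(\overline\rho_{ij}^n,\overline{\bm v}_{ij}^n,\overline p_{ij}^n)^\top$ are the primitive variables of the cell average $\overline{\bm Q}_{ij}^n$. Slopes are computed componentwise by the van Albada limiter: for a scalar component $W$ with $a=(\overline W_{ij}^n-\overline W_{i-1,j}^n)/\Delta x$, $b=(\overline W_{i+1,j}^n-\overline W_{ij}^n)/\Delta x$, $\epsilon_x=3\Delta x$, set $\delta W_{ij}^x=\frac{(b^2+\epsilon_x)a+(a^2+\epsilon_x)b}{a^2+b^2+2\epsilon_x}$; $\delta W_{ij}^y$ is defined analogously in the $y$-direction with $\epsilon_y=3\Delta y$. The increments are $(\Delta\rho_{ij}^x,\Delta\bm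 v_{ij}^x,\Delta p_{ij}^x)^\top=\frac{\Delta x}{2}\delta\bm W_{ij}^x$ and $(\Delta\rho_{ij}^y,\Delta\bm v_{ij}^y,\Delta p_{ij}^y)^\top=\frac{\Delta y}{2}\delta\bm W_{ij}^y$. PP limiter with parameter $q>2$: put $C_x=\frac{\alpha_1\Delta y}{\alpha_1\Delta y+\alpha_2\Delta x}$, $C_y=\frac{\alpha_2\Delta x}{\alpha_1\Delta y+\alpha_2\Delta x}$. For $\star\in\{x,y\}$: $\alpha^\star=\min\left(\frac{\overline\rho_{ij}^n}{|\Delta\rho_{ij}^\star|(1+\epsilon)},1\right)$ if $\Delta\rho_{ij}^\star\ne0$ and $\alpha^\star=1$ otherwise; $\kappa^\star=\min\left(\frac{\overline p_{ij}^n}{|\Delta p_{ij}^\star|(1+\epsilon)},1\right)$ if $\Delta p_{ij}^\star\neq0$ and $\kappa^\star=1$ otherwise. If $|\Delta\bm v_{ij}^x|+|\Delta\bm v_{ij}^y|\ne0$, $$\beta=\min\left(\sqrt{\frac{(q-2)^2\,\overline\rho_{ij}^n\,\overline p_{ij}^n}{(\gamma-1)\left(2\left|C_x\alpha^x\Delta\rho_{ij}^x\Delta\bm v_{ij}^x+C_y\alpha^y\Delta\rho_{ij}^y\Delta\bm v_{ij}^y\right|^2+(q-2)(\overline\rho_{ij}^n)^2\left(C_x|\Delta\bm v_{ij}^x|^2+C_y|\Delta\bm v_{ij}^y|^2\right)\right)}},\,1\right),$$ and $\beta=1$ otherwise. The modified primitive limiting values are $\widetilde{\bm W}^{n,\mp}_{i\pm\frac12,j}=(\overline\rho_{ij}^n\pm\alpha^x\Delta\rho_{ij}^x,\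 \overline{\bm v}_{ij}^n\pm\beta\Delta\bm v_{ij}^x,\ \overline p_{ij}^n\pm\kappa^x\Delta p_{ij}^x)^\top$ and $\widetilde{\bm W}^{n,\mp}_{i,j\pm\frac12}=(\overline\rho_{ij}^n\pm\alpha^y\Delta\rho_{ij}^y,\ \overline{\bm v}_{ij}^n\pm\beta\Delta\bm v_{ij}^y,\ \overline p_{ij}^n\pm\kappa^y\Delta p_{ij}^y)^\top$, and $\widetilde{\bm Q}$ (same indices) denotes the conservative state with primitive variables $\widetilde{\bm W}$. *)

theory Defs
  imports "HOL-Analysis.Analysis"
begin

text \<open>
  Triples \<open>(\<rho>, m, E)\<close> of conservative variables and \<open>(\<rho>, v, p)\<close> of primitive variables have the
  same type; its product inner product is the Euclidean dot product on the five components.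
\<close>

type_synonym state = "real \<times> (real^3) \<times> real"

definition admissible :: "state set" where
  "admissible = {(\<rho>, m, E). \<rho> > 0 \<and> E - (norm m)\<^sup>2 / (2 * \<rho>) > 0}"

definition to_prim :: "real \<Rightarrow> state \<Rightarrow> state" where
  "to_prim \<gamma> = (\<lambda>(\<rho>, m, E). (\<rho>, (1 / \<rho>) *\<^sub>R m, (\<gamma> - 1) * (E - (norm m)\<^sup>2 / (2 * \<rho>))))"

definition to_cons :: "real \<Rightarrow> state \<Rightarrow> state" where
  "to_cons \<gamma> = (\<lambda>(\<rho>, v, p). (\<rho>, \<rho> *\<^sub>R v, p / (\<gamma> - 1) + 1 / 2 * \<rho> * (norm v)\<^sup>2))"

lemma to_prim_to_cons:
  assumes "\<gamma> \<noteq> 1" "\<rho> \<noteq> 0"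
  shows "to_prim \<gamma> (to_cons \<gamma> (\<rho>, v, p)) = (\<rho>, v, p)"
proof -
  have key: "(norm (\<rho> *\<^sub>R v))\<^sup>2 / (2 * \<rho>) = 1 / 2 * \<rho> * (norm v)\<^sup>2"
    using assms(2) by (simp add: power_mult_distrib) (simp add: power2_eq_square)
  show ?thesis
    unfolding to_prim_def to_cons_def prod.case key using assms by simp
qed

lemma to_cons_to_prim:
  assumes "\<gamma> \<noteq> 1" "\<rho> \<noteq> 0"
  shows "to_cons \<gamma> (to_prim \<gamma> (\<rho>, m, E)) = (\<rho>, m, E)"
proof -
  have key: "1 / 2 * \<rho> * (norm ((1 / \<rho>) *\<^sub>R m))\<^sup>2 = (norm m)\<^sup>2 / (2 * \<rho>)"
    using assms(2) by (simp add: power_divide) (simp add: power2_eq_square)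
  show ?thesis
    unfolding to_prim_def to_cons_def prod.case key using assms by simp
qed

text \<open>
  Van Albada slope of a scalar quantity on a mesh of size \<open>h\<close>, from the values in the previous, the
  current and the next cell; the regularization parameter is \<open>3 h\<close>.
\<close>

definition van_albada :: "real \<Rightarrow> real \<Rightarrow> real \<Rightarrow> real \<Rightarrow> real" where
  "van_albada h w_prev w w_next =
     (let a = (w - w_prev) / h;
          b = (w_next - w) / h;
          e = 3 * h
      in ((b\<^sup>2 + e) * a + (a\<^sup>2 + e) * b) / (a\<^sup>2 + b\<^sup>2 + 2 * e))"

definition slope :: "real \<Rightarrow> state \<Rightarrow> state \<Rightarrow> state \<Rightarrow> state" where
  "slope h = (\<lambda>(\<rho>_prev, v_prev, p_prev) (\<rho>, v, p) (\<rho>_next, v_next, p_next).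
     (van_albada h \<rho>_prev \<rho> \<rho>_next,
      (\<chi> k. van_albada h (v_prev $ k) (v $ k) (v_next $ k)),
      van_albada h p_prev p p_next))"

text \<open>
  The factor applied to the increment \<open>d\<close> of a positive quantity \<open>u\<close>: \<open>\<alpha>\<^sup>\<star>\<close> for the density and
  \<open>\<kappa>\<^sup>\<star>\<close> for the pressure.
\<close>

definition scaling :: "real \<Rightarrow> real \<Rightarrow> real \<Rightarrow> real" where
  "scaling \<epsilon> u d = (if d \<noteq> 0 then min (u / (\<bar>d\<bar> * (1 + \<epsilon>))) 1 else 1)"

definition normal_star :: "real^3 \<Rightarrow> state" where
  "normal_star v = ((norm v)\<^sup>2 / 2, - v, 1)"

text \<open>
  The limiter in the cell with indices \<open>i\<close>, \<open>j\<close>, where \<open>Q k l\<close> is the (conservative) average over the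
  cell with indices \<open>k\<close>, \<open>l\<close> at the current time level. The locale carries no assumptions and
  only supplies the parameters of the definitions.
\<close>

locale pp_limiter =
  fixes \<gamma> \<Delta>x \<Delta>y \<alpha>\<^sub>1 \<alpha>\<^sub>2 \<epsilon> q :: real
    and Q :: "int \<Rightarrow> int \<Rightarrow> state"
    and i j :: int
begin

definition W :: "int \<Rightarrow> int \<Rightarrow> state" where
  "W k l = to_prim \<gamma> (Q k l)"

definition incr_x :: state where
  "incr_x = (\<Delta>x / 2) *\<^sub>R slope \<Delta>x (W (i - 1) j) (W i j) (W (i + 1) j)"

definition incr_y :: state where
  "incr_y = (\<Delta>y / 2) *\<^sub>R slope \<Delta>y (W i (j - 1)) (W i j) (W i (j + 1))"

definition C_x :: real where
  "C_x = \<alpha>\<^sub>1 * \<Delta>y / (\<alpha>\<^sub>1 * \<Delta>y + \<alpha>\<^sub>2 * \<Delta>x)"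

definition C_y :: real where
  "C_y = \<alpha>\<^sub>2 * \<Delta>x / (\<alpha>\<^sub>1 * \<Delta>y + \<alpha>\<^sub>2 * \<Delta>x)"

definition \<beta> :: real where
  "\<beta> =
     (let (\<rho>, v, p) = W i j;
          (d\<rho>x, dvx, dpx) = incr_x;
          (d\<rho>y, dvy, dpy) = incr_y;
          \<alpha>x = scaling \<epsilon> \<rho> d\<rho>x;
          \<alpha>y = scaling \<epsilon> \<rho> d\<rho>y
      in if norm dvx + norm dvy \<noteq> 0
         then min (sqrt ((q - 2)\<^sup>2 * \<rho> * p /
                ((\<gamma> - 1) *
                 (2 * (norm ((C_x * \<alpha>x * d\<rho>x) *\<^sub>R dvx + (C_y * \<alpha>y * d\<rho>y) *\<^sub>R dvy))\<^sup>2
                  + (q - 2) * \<rho>\<^sup>2 * (C_x * (norm dvx)\<^sup>2 + C_y * (norm dvy)\<^sup>2))))) 1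
         else 1)"

text \<open>
  The primitive cell value plus (\<open>s = 1\<close>) or minus (\<open>s = -1\<close>) the increment \<open>d\<close>, after scaling the
  components of \<open>d\<close> by the limiter.
\<close>

definition limited :: "state \<Rightarrow> real \<Rightarrow> state" where
  "limited d s =
     (let (\<rho>, v, p) = W i j;
          (d\<rho>, dv, dp) = d
      in (\<rho> + s * (scaling \<epsilon> \<rho> d\<rho> * d\<rho>),
          v + s *\<^sub>R (\<beta> *\<^sub>R dv),
          p + s * (scaling \<epsilon> p dp * dp)))"

text \<open>
  The modified limiting values inside the cell on its four edges: east is the minus state at
  \<open>i + 1/2, j\<close>, west the plus state at \<open>i - 1/2, j\<close>, north the minus state at \<open>i, j + 1/2\<close> and
  south the plus state at \<open>i, j - 1/2\<close>.
\<close>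

definition Q_east :: state where
  "Q_east = to_cons \<gamma> (limited incr_x 1)"

definition Q_west :: state where
  "Q_west = to_cons \<gamma> (limited incr_x (- 1))"

definition Q_north :: state where
  "Q_north = to_cons \<gamma> (limited incr_y 1)"

definition Q_south :: state where
  "Q_south = to_cons \<gamma> (limited incr_y (- 1))"

end

end

theory Submission
  imports Defs
begin

text \<open>
  In primitive variables \<open>Q \<bullet> n\<^sub>* = p / (\<gamma> - 1) + \<rho> |v - v\<^sub>*|\<^sup>2 / 2\<close>. Put \<open>w = v - v\<^sub>*\<close> for the cell
  average. The pressure increments cancel in the sum over opposite edges, and the difference of the
  two sides of the inequality is a quadratic polynomial in \<open>w\<close> with leading coefficient
  \<open>(q - 2) \<rho> / 2 > 0\<close>. Completing the square, it is nonnegative for all \<open>w\<close> if and only if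
  \<open>\<beta>\<^sup>2 (\<gamma> - 1) (2 |M|\<^sup>2 + (q - 2) \<rho>\<^sup>2 S) \<le> (q - 2)\<^sup>2 \<rho> p\<close>, where \<open>M\<close> is the weighted sum of
  the \<open>\<alpha> \<Delta>\<rho> \<Delta>v\<close> and \<open>S\<close> that of the \<open>|\<Delta>v|\<^sup>2\<close>; this is exactly what the choice of \<open>\<beta>\<close> ensures.
\<close>

text \<open>The kinetic energy cancels, so the internal energy is
  \<open>p / (\<gamma> - 1)\<close>.\<close>

lemma to_cons_admissible:
  assumes "\<gamma> > 1" "\<rho> > 0" "p > 0"
  shows "to_cons \<gamma> (\<rho>, v, p) \<in> admissible"
proof -
  have key: "(norm (\<rho> *\<^sub>R v))\<^sup>2 / (2 * \<rho>) = 1 / 2 * \<rho> * (norm v)\<^sup>2"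
    using assms by (simp add: power_mult_distrib) (simp add: power2_eq_square)
  show ?thesis
    unfolding to_cons_def admissible_def prod.case mem_Collect_eq key using assms by simp
qed

lemma to_prim_admissible:
  assumes "\<gamma> > 1" "Q \<in> admissible"
  obtains \<rho> v p where "to_prim \<gamma> Q = (\<rho>, v, p)" "\<rho> > 0" "p > 0" "Q = to_cons \<gamma> (\<rho>, v, p)"
proof -
  obtain \<rho> m E where Q: "Q = (\<rho>, m, E)"
    by (cases Q)
  with assms have pos: "\<rho> > 0" "E - (norm m)\<^sup>2 / (2 * \<rho>) > 0"
    by (auto simp: admissible_def)
  show ?thesis
  proof (rule that)
    show prim: "to_prim \<gamma> Q = (\<rho>, (1 / \<rho>) *\<^sub>R m, (\<gamma> - 1) * (E - (norm m)\<^sup>2 / (2 * \<rho>)))"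
      by (simp add: Q to_prim_def)
    show "\<rho> > 0" "(\<gamma> - 1) * (E - (norm m)\<^sup>2 / (2 * \<rho>)) > 0"
      using pos assms(1) by (auto intro: mult_pos_pos)
    show "Q = to_cons \<gamma> (\<rho>, (1 / \<rho>) *\<^sub>R m, (\<gamma> - 1) * (E - (norm m)\<^sup>2 / (2 * \<rho>)))"
      using to_cons_to_prim[of \<gamma> \<rho> m E] assms(1) pos(1) prim Q by simp
  qed
qed

text \<open>The cap leaves an increment of size at most \<open>u / (1 + \<epsilon>)\<close>. The
  factor \<open>1 + \<epsilon>\<close> makes the bound strict, so adding or subtracting the scaled
  increment keeps \<open>u\<close> positive.\<close>

lemma abs_scaling_mult_less:
  assumes "u > 0" "\<epsilon> > 0"
  shows "\<bar>scaling \<epsilon> u d * d\<bar> < u"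
proof (cases "d = 0")
  case False
  have "\<bar>scaling \<epsilon> u d\<bar> \<le> u / (\<bar>d\<bar> * (1 + \<epsilon>))"
    using assms False by (simp add: scaling_def)
  then have "\<bar>scaling \<epsilon> u d * d\<bar> \<le> u / (\<bar>d\<bar> * (1 + \<epsilon>)) * \<bar>d\<bar>"
    unfolding abs_mult by (rule mult_right_mono) simp
  also have "\<dots> = u / (1 + \<epsilon>)"
    using False by simp
  also have "\<dots> < u"
    using assms by (simp add: field_simps)
  finally show ?thesis .
qed (use assms in simp)

lemma to_cons_inner_normal_star:
  "to_cons \<gamma> (\<rho>, v, p) \<bullet> normal_star u = p / (\<gamma> - 1) + \<rho> / 2 * ((v - u) \<bullet> (v - u))"
  by (simp add: to_cons_def normal_star_def power2_norm_eq_inner inner_diff_left inner_diff_right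
      inner_commute algebra_simps add_divide_distrib diff_divide_distrib)

text \<open>Here \<open>a\<close> and \<open>d\<close> play the density and velocity increments.
  Terms that change sign with \<open>(a, d)\<close> cancel, among them the cubic
  \<open>a * (d \<bullet> d)\<close>.\<close>

lemma opposite_sum:
  fixes w d :: "'a::real_inner"
  shows "(\<rho> + a) / 2 * ((w + d) \<bullet> (w + d)) + (\<rho> - a) / 2 * ((w - d) \<bullet> (w - d))
    = \<rho> * (w \<bullet> w) + \<rho> * (d \<bullet> d) + 2 * a * (w \<bullet> d)"
  by (simp add: inner_simps inner_commute field_simps)

text \<open>Multiplied by \<open>k\<close>, the right-hand side is
  \<open>(k *\<^sub>R w - m) \<bullet> (k *\<^sub>R w - m)\<close> plus
  \<open>k * c - m \<bullet> m\<close>.\<close>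

lemma quadratic_nonneg:
  fixes w m :: "'a::real_inner" and k c :: real
  assumes "k > 0" "m \<bullet> m \<le> k * c"
  shows "0 \<le> k * (w \<bullet> w) - 2 * (w \<bullet> m) + c"
proof -
  have "0 \<le> (k *\<^sub>R w - m) \<bullet> (k *\<^sub>R w - m)"
    by simp
  also have "\<dots> = k * (k * (w \<bullet> w) - 2 * (w \<bullet> m)) + m \<bullet> m"
    by (simp add: inner_simps inner_commute algebra_simps)
  also have "\<dots> \<le> k * (k * (w \<bullet> w) - 2 * (w \<bullet> m) + c)"
    using assms(2) by (simp add: algebra_simps)
  finally show ?thesis
    using assms(1) by (simp add: zero_le_mult_iff)
qed

text \<open>For \<open>D = 0\<close> the quotient has the junk value \<open>0\<close>, with which the bound still holds.\<close>

lemma min_sqrt_power2_mult_le: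
  fixes N D :: real
  assumes "0 \<le> N" "0 \<le> D"
  shows "(min (sqrt (N / D)) 1)\<^sup>2 * D \<le> N"
proof (cases "D = 0")
  case False
  have "(min (sqrt (N / D)) 1)\<^sup>2 \<le> (sqrt (N / D))\<^sup>2"
    using assms by (intro power_mono) auto
  then have "(min (sqrt (N / D)) 1)\<^sup>2 \<le> N / D"
    using assms by simp
  then show ?thesis
    using assms False by (simp add: pos_le_divide_eq)
qed (use assms in simp)

text \<open>Clearing the root and the quotient gives one bound for both branches of
  \<open>\<beta>\<close>: where \<beta> is 1 by default, both velocity increments vanish and so does
  the left side.\<close>

lemma (in pp_limiter) beta_bound:
  assumes "W i j = (\<rho>, v, p)" "incr_x = (rx, dx, px)" "incr_y = (ry, dy, py)"
    and "\<gamma> > 1" "q > 2" "\<rho> > 0" "p > 0" "C_x \<ge> 0" "C_y \<ge> 0"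
  shows "\<beta>\<^sup>2 * ((\<gamma> - 1) * (2 * (norm ((C_x * scaling \<epsilon> \<rho> rx * rx) *\<^sub>R dx
        + (C_y * scaling \<epsilon> \<rho> ry * ry) *\<^sub>R dy))\<^sup>2
      + (q - 2) * \<rho>\<^sup>2 * (C_x * (norm dx)\<^sup>2 + C_y * (norm dy)\<^sup>2))) \<le> (q - 2)\<^sup>2 * \<rho> * p"
    (is "\<beta>\<^sup>2 * ?D \<le> ?N")
proof (cases "norm dx + norm dy = 0")
  case True
  then have "dx = 0" "dy = 0"
    by (simp_all add: add_nonneg_eq_0_iff)
  then show ?thesis
    using assms by simp
next
  case False
  then have "\<beta> = min (sqrt (?N / ?D)) 1"
    by (simp only: \<beta>_def assms(1-3) Let_def prod.case if_True not_False_eq_True simp_thms)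
  moreover have "0 \<le> ?N" "0 \<le> ?D"
    using assms by simp_all
  ultimately show ?thesis
    using min_sqrt_power2_mult_le[of ?N ?D] by simp
qed

lemma (in pp_limiter) limited_admissible:
  assumes "W i j = (\<rho>, v, p)" "\<gamma> > 1" "\<epsilon> > 0" "\<rho> > 0" "p > 0" and s: "s = 1 \<or> s = - 1"
  shows "to_cons \<gamma> (limited d s) \<in> admissible"
proof -
  obtain r dv dp where d: "d = (r, dv, dp)"
    by (cases d)
  have "\<rho> + s * (scaling \<epsilon> \<rho> r * r) > 0" "p + s * (scaling \<epsilon> p dp * dp) > 0"
    using abs_scaling_mult_less[of \<rho> \<epsilon> r] abs_scaling_mult_less[of p \<epsilon> dp] assms by auto
  then show ?thesis
    using assms by (simp add: limited_def d to_cons_admissible)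
qed

lemma (in pp_limiter) limited_opposite_sum:
  assumes "W i j = (\<rho>, v, p)"
  shows "(to_cons \<gamma> (limited (r, dv, dp) 1) + to_cons \<gamma> (limited (r, dv, dp) (- 1))) \<bullet> normal_star u
    = 2 * p / (\<gamma> - 1) + \<rho> * ((v - u) \<bullet> (v - u)) + \<rho> * \<beta>\<^sup>2 * (norm dv)\<^sup>2
      + 2 * \<beta> * (scaling \<epsilon> \<rho> r * r) * ((v - u) \<bullet> dv)"
proof -
  define w where "w = v - u"
  define a where "a = scaling \<epsilon> \<rho> r * r"
  have "v + \<beta> *\<^sub>R dv - u = w + \<beta> *\<^sub>R dv" "v - \<beta> *\<^sub>R dv - u = w - \<beta> *\<^sub>R dv"
    by (simp_all add: w_def)
  then have "(to_cons \<gamma> (limited (r, dv, dp) 1) + to_cons \<gamma> (limited (r, dv, dp) (- 1))) \<bullet> normal_star u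
    = 2 * p / (\<gamma> - 1) + ((\<rho> + a) / 2 * ((w + \<beta> *\<^sub>R dv) \<bullet> (w + \<beta> *\<^sub>R dv))
      + (\<rho> - a) / 2 * ((w - \<beta> *\<^sub>R dv) \<bullet> (w - \<beta> *\<^sub>R dv)))"
    \<comment> \<open>This instance of \<open>inner_add_left\<close> splits only the sum of the two
      states, so \<open>w + \<beta> *\<^sub>R dv\<close> stays intact for
      \<open>opposite_sum\<close>.\<close>
    by (simp only: limited_def assms Let_def prod.case inner_add_left[of "to_cons _ _"]
        to_cons_inner_normal_star mult_1 scaleR_one mult_minus1 scaleR_minus1_left
        flip: a_def diff_conv_add_uminus)
      (simp add: add_divide_distrib diff_divide_distrib)
  then show ?thesis
    unfolding opposite_sum power2_norm_eq_inner w_def[symmetric] a_def[symmetric]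
    by (simp add: power2_eq_square)
qed

lemma (in pp_limiter) edge_sum_le:
  assumes W: "W i j = (\<rho>, v, p)" and "\<gamma> > 1" "q > 2" "\<rho> > 0" "p > 0" "C_x \<ge> 0" "C_y \<ge> 0"
    and C: "C_x + C_y = 1"
  shows "C_x * ((Q_east + Q_west) \<bullet> normal_star u) + C_y * ((Q_south + Q_north) \<bullet> normal_star u)
    \<le> q * (to_cons \<gamma> (\<rho>, v, p) \<bullet> normal_star u)"
proof -
  obtain rx dx px where X: "incr_x = (rx, dx, px)"
    by (cases incr_x)
  obtain ry dy py where Y: "incr_y = (ry, dy, py)"
    by (cases incr_y)
  define w where "w = v - u"
  define ax where "ax = scaling \<epsilon> \<rho> rx * rx"
  define ay where "ay = scaling \<epsilon> \<rho> ry * ry"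
  define M where "M = (C_x * ax) *\<^sub>R dx + (C_y * ay) *\<^sub>R dy"
  define S where "S = C_x * (norm dx)\<^sup>2 + C_y * (norm dy)\<^sup>2"
  \<comment> \<open>\<open>k\<close>, \<open>m\<close> and \<open>c\<close> are the coefficients of
    the difference of the two sides as a quadratic in \<open>w\<close>.\<close>
  define m where "m = \<beta> *\<^sub>R M"
  define k where "k = (q - 2) / 2 * \<rho>"
  define P where "P = p / (\<gamma> - 1)"
  define c where "c = (q - 2) * P - \<rho> * \<beta>\<^sup>2 * S"
  have "\<beta>\<^sup>2 * ((\<gamma> - 1) * (2 * (M \<bullet> M) + (q - 2) * \<rho>\<^sup>2 * S)) \<le> (q - 2)\<^sup>2 * \<rho> * p"
    using beta_bound[OF W X Y] assms
    by (simp add: M_def S_def ax_def ay_def mult.assoc flip: power2_norm_eq_inner)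
  then have "\<beta>\<^sup>2 * (2 * (M \<bullet> M) + (q - 2) * \<rho>\<^sup>2 * S) \<le> (q - 2)\<^sup>2 * \<rho> * P"
    using \<open>\<gamma> > 1\<close> by (simp add: P_def pos_le_divide_eq mult_ac)
  \<comment> \<open>This is half of the previous bound, with the term in \<open>S\<close> moved to
    the right.\<close>
  then have "m \<bullet> m \<le> k * c"
    by (simp add: m_def k_def c_def power2_eq_square field_simps)
  moreover have "k > 0"
    using assms by (simp add: k_def)
  ultimately have nonneg: "0 \<le> k * (w \<bullet> w) - 2 * (w \<bullet> m) + c"
    by (intro quadratic_nonneg)
  have EW: "(Q_east + Q_west) \<bullet> normal_star u
      = 2 * P + \<rho> * (w \<bullet> w) + \<rho> * \<beta>\<^sup>2 * (norm dx)\<^sup>2 + 2 * \<beta> * ax * (w \<bullet> dx)"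
    unfolding Q_east_def Q_west_def X limited_opposite_sum[OF W] by (simp add: w_def ax_def P_def)
  have SN: "(Q_south + Q_north) \<bullet> normal_star u
      = 2 * P + \<rho> * (w \<bullet> w) + \<rho> * \<beta>\<^sup>2 * (norm dy)\<^sup>2 + 2 * \<beta> * ay * (w \<bullet> dy)"
    unfolding Q_north_def Q_south_def Y add.commute[of "to_cons \<gamma> (limited _ (- 1))"]
      limited_opposite_sum[OF W] by (simp add: w_def ay_def P_def)
  have avg: "to_cons \<gamma> (\<rho>, v, p) \<bullet> normal_star u = P + \<rho> / 2 * (w \<bullet> w)"
    by (simp add: to_cons_inner_normal_star w_def P_def)
  have wm: "w \<bullet> m = \<beta> * (C_x * ax * (w \<bullet> dx) + C_y * ay * (w \<bullet> dy))"
    by (simp add: m_def M_def inner_add_right)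
  \<comment> \<open>Since the weights sum to 1, the common part
    \<open>2 * P + \<rho> * (w \<bullet> w)\<close> of both edge sums appears once; eliminating
    \<open>C_y\<close> leaves a polynomial identity.\<close>
  have Cy: "C_y = 1 - C_x"
    using C by simp
  have "k * (w \<bullet> w) - 2 * (w \<bullet> m) + c
      = q * (P + \<rho> / 2 * (w \<bullet> w))
        - (C_x * (2 * P + \<rho> * (w \<bullet> w) + \<rho> * \<beta>\<^sup>2 * (norm dx)\<^sup>2 + 2 * \<beta> * ax * (w \<bullet> dx))
          + C_y * (2 * P + \<rho> * (w \<bullet> w) + \<rho> * \<beta>\<^sup>2 * (norm dy)\<^sup>2 + 2 * \<beta> * ay * (w \<bullet> dy)))"
    unfolding wm k_def c_def S_def Cy by (simp add: field_simps)
  with nonneg show ?thesis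
    unfolding EW SN avg by simp
qed

theorem theorem3p5:
  fixes \<gamma> \<Delta>x \<Delta>y \<alpha>\<^sub>1 \<alpha>\<^sub>2 \<epsilon> q :: real
    and Q :: "int \<Rightarrow> int \<Rightarrow> state"
    and i j :: int
  assumes "\<gamma> > 1" and "\<Delta>x > 0" and "\<Delta>y > 0" and "\<alpha>\<^sub>1 > 0" and "\<alpha>\<^sub>2 > 0" and "\<epsilon> > 0"
    and "q > 2"
    and "Q i j \<in> admissible"
  shows "let Q_E = pp_limiter.Q_east \<gamma> \<Delta>x \<Delta>y \<alpha>\<^sub>1 \<alpha>\<^sub>2 \<epsilon> q Q i j;
             Q_W = pp_limiter.Q_west \<gamma> \<Delta>x \<Delta>y \<alpha>\<^sub>1 \<alpha>\<^sub>2 \<epsilon> q Q i j;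
             Q_N = pp_limiter.Q_north \<gamma> \<Delta>x \<Delta>y \<alpha>\<^sub>1 \<alpha>\<^sub>2 \<epsilon> q Q i j;
             Q_S = pp_limiter.Q_south \<gamma> \<Delta>x \<Delta>y \<alpha>\<^sub>1 \<alpha>\<^sub>2 \<epsilon> q Q i j;
             C_x = pp_limiter.C_x \<Delta>x \<Delta>y \<alpha>\<^sub>1 \<alpha>\<^sub>2;
             C_y = pp_limiter.C_y \<Delta>x \<Delta>y \<alpha>\<^sub>1 \<alpha>\<^sub>2
         in (Q_W \<in> admissible \<and> Q_E \<in> admissible \<and> Q_S \<in> admissible \<and> Q_N \<in> admissible) \<and>
            (\<forall>v :: real^3.
               q * (Q i j \<bullet> normal_star v)
               \<ge> C_x * ((Q_E + Q_W) \<bullet> normal_star v) + C_y * ((Q_S + Q_N) \<bullet> normal_star v))"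
proof -
  interpret pp_limiter \<gamma> \<Delta>x \<Delta>y \<alpha>\<^sub>1 \<alpha>\<^sub>2 \<epsilon> q Q i j .
  obtain \<rho> v p where W: "W i j = (\<rho>, v, p)" and pos: "\<rho> > 0" "p > 0"
    and Q: "Q i j = to_cons \<gamma> (\<rho>, v, p)"
    using to_prim_admissible[OF assms(1,8)] unfolding W_def by metis
  \<comment> \<open>Positive products make the common denominator nonzero, so \<open>C_x\<close> and
    \<open>C_y\<close> are convex weights.\<close>
  have "\<alpha>\<^sub>1 * \<Delta>y > 0" "\<alpha>\<^sub>2 * \<Delta>x > 0"
    using assms by simp_all
  then have "C_x \<ge> 0" "C_y \<ge> 0" "C_x + C_y = 1"
    by (simp_all add: C_x_def C_y_def flip: add_divide_distrib)
  then show ?thesis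
    using edge_sum_le[OF W assms(1,7) pos] limited_admissible[OF W assms(1,6) pos]
    by (simp add: Let_def Q Q_east_def Q_west_def Q_north_def Q_south_def)
qed

end
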